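(* Let $(X,\|\cdot\|)$ be a finite-dimensional real normed space and let $K\subseteq X$ be a convex body. Then the distance function $d_K:X\to\mathbb{R}$, $d_K(x)=\inf\{\|x-y\|:y\in K\}$, is a convex function.
   Context: A convex body is a compact convex set with non-empty interior. The norm is arbitrary (neither smoothness nor strict convexity is assumed). *)

theory Defs
  imports "HOL-Analysis.Analysis"
begin

definition convex_body :: "'a::real_normed_vector set \<Rightarrow> bool" where
  "convex_body K \<longleftrightarrow> convex K \<and> compact K \<and> interior K \<noteq> {}"

end

theory Submission
  imports Defs
begin

text \<open>Near-minimizers of the distance can be averaged. If \<open>a\<close> and
  \<open>b\<close> in \<open>K\<close> nearly realize the distances from \<open>x\<close> and
  \<open>y\<close>, then by convexity \<open>u *\<^sub>R a + v *\<^sub>R b\<close> is a competitor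
  in \<open>K\<close> for the point \<open>u *\<^sub>R x + v *\<^sub>R y\<close>, and the triangle
  inequality and homogeneity of the norm bound its distance by the same average of the two
  distances. Letting the error tend to 0 gives convexity. \<open>infdist_almost_attained\<close>
  supplies the near-minimizers, \<open>convex_on_infdist\<close> the averaging.\<close>

lemma infdist_almost_attained:
  assumes "A \<noteq> {}" "e > 0"
  obtains a where "a \<in> A" "dist x a < infdist x A + e"
proof -
  have "(INF a\<in>A. dist x a) < infdist x A + e"
    using assms by (simp add: infdist_notempty)
  then show ?thesis
    using assms(1) that by (auto simp: cINF_less_iff)
qed

lemma convex_on_infdist:
  fixes K :: "'a::real_normed_vector set"
  assumes "convex K"
  shows "convex_on UNIV (\<lambda>x. infdist x K)"
proof (cases "K = {}")
  case True
  \<comment> \<open>By convention \<open>infdist x {}\<close> is 0, so the function is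
    constant.\<close>
  then show ?thesis
    by (simp add: infdist_def convex_on_def)
next
  case False
  have "infdist (u *\<^sub>R x + v *\<^sub>R y) K \<le> u * infdist x K + v * infdist y K"
    if uv: "u \<ge> 0" "v \<ge> 0" "u + v = 1" for x y :: 'a and u v :: real
  proof (rule field_le_epsilon)
    fix e :: real
    assume "e > 0"
    obtain a where a: "a \<in> K" "dist x a < infdist x K + e"
      using infdist_almost_attained[OF False \<open>e > 0\<close>] .
    obtain b where b: "b \<in> K" "dist y b < infdist y K + e"
      using infdist_almost_attained[OF False \<open>e > 0\<close>] .
    have "u *\<^sub>R a + v *\<^sub>R b \<in> K"
      using assms a(1) b(1) uv by (rule convexD)
    then have "infdist (u *\<^sub>R x + v *\<^sub>R y) K \<le> dist (u *\<^sub>R x + v *\<^sub>R y) (u *\<^sub>R a + v *\<^sub>R b)"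
      by (rule infdist_le)
    also have "\<dots> \<le> dist (u *\<^sub>R x) (u *\<^sub>R a) + dist (v *\<^sub>R y) (v *\<^sub>R b)"
      by (rule dist_triangle_add)
    also have "\<dots> = u * dist x a + v * dist y b"
      using uv by (simp add: dist_norm flip: scaleR_diff_right)
    also have "\<dots> \<le> u * (infdist x K + e) + v * (infdist y K + e)"
      using a(2) b(2) uv by (intro add_mono mult_left_mono) auto
    also have "\<dots> = u * infdist x K + v * infdist y K + (u + v) * e"
      by (simp add: algebra_simps)
    \<comment> \<open>The weights sum to 1, so the two errors average to exactly
      \<open>e\<close>.\<close>
    finally show "infdist (u *\<^sub>R x + v *\<^sub>R y) K \<le> u * infdist x K + v * infdist y K + e"
      using uv(3) by simp
  qed
  then show ?thesis
    by (simp add: convex_on_def)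
qed

theorem proposition3p1:
  fixes K :: "'a::real_normed_vector set"
  assumes "\<exists>B :: 'a set. finite B \<and> span B = UNIV"
    and "convex_body K"
  shows "convex_on UNIV (\<lambda>x. infdist x K)"
  using assms(2) by (simp add: convex_body_def convex_on_infdist)

end
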